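(* Let $\alpha\in[g,G]$. The measure $d\mu_\alpha=(1+xy)^{-2}\,dx\,dy$ is $\Phi_\alpha$-invariant on $\Omega_\alpha$ and $\mu_\alpha(\Omega_\alpha)=3\log G$.
   Context: $g=\frac12(\sqrt5-1)$, $G=\frac12(\sqrt5+1)$, $[\cdot]$ in the formula for $d_\alpha$ is the integer part (floor). $I_\alpha=[\alpha-2,\alpha)$. For $x\ne0$, $d_\alpha(x)=2\left[\frac1{2|x|}+\frac{1-\alpha}2\right]+1$ and $\varphi_\alpha(x)=\frac1{|x|}-d_\alpha(x)$, with $\varphi_\alpha(0)=0$; the same formulas at $x=\alpha$ define $\varphi_\alpha(\alpha)=\frac1\alpha-d_\alpha(\alpha)$. With $e(x)=\operatorname{sign}(x)$, define for $x\neq0$ $$\Phi_\alpha(x,y)=\left(\varphi_\alpha(x),\frac1{d_\alpha(x)+e(x)y}\right).$$ For $g<\alpha<G$, $$\Omega_\alpha=\big(I_\alpha\times[0,2-G)\big)\cup\big((\varphi_\alpha(\alpha),\alpha)\times(2-G,1]\big)\cup\big([\varphi_\alpha(\alpha-2),\alpha)\times[1,G)\big),$$ while $\Omega_g=\big([g-2,g)\times[0,1-g)\big)\cup\big([\frac{g-1}{2-g},g)\times[1,G)\big)$ and $\Omega_G=[G-2,G)\times[0,1)$. The map $\Phi_\alpha$ is a bijection of $\Omega_\alpha$ onto itself up to sets of Lebesgue measure zero. *)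

theory Defs
  imports "HOL-Analysis.Analysis"
begin

definition g_const :: real where
  "g_const = (sqrt 5 - 1) / 2"

definition G_const :: real where
  "G_const = (sqrt 5 + 1) / 2"

definition I_interval :: "real \<Rightarrow> real set" where
  "I_interval \<alpha> = {\<alpha> - 2 ..< \<alpha>}"

text \<open>The digit is only meaningful for \<open>x \<noteq> 0\<close>.\<close>

definition digit :: "real \<Rightarrow> real \<Rightarrow> int" where
  "digit \<alpha> x = 2 * \<lfloor>1 / (2 * \<bar>x\<bar>) + (1 - \<alpha>) / 2\<rfloor> + 1"

definition phi :: "real \<Rightarrow> real \<Rightarrow> real" where
  "phi \<alpha> x = (if x = 0 then 0 else 1 / \<bar>x\<bar> - of_int (digit \<alpha> x))"

text \<open>
  The map is specified only for \<open>x \<noteq> 0\<close>. The value on the line \<open>x = 0\<close>, a null set,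
  merely makes the function total (it corresponds to reading the digit of \<open>0\<close> as infinity).
\<close>

definition Phi :: "real \<Rightarrow> real \<times> real \<Rightarrow> real \<times> real" where
  "Phi \<alpha> = (\<lambda>(x, y). if x = 0 then (0, 0)
      else (phi \<alpha> x, 1 / (of_int (digit \<alpha> x) + sgn x * y)))"

definition Omega :: "real \<Rightarrow> (real \<times> real) set" where
  "Omega \<alpha> =
    (if \<alpha> = g_const then
       I_interval g_const \<times> {0 ..< 1 - g_const}
       \<union> {(g_const - 1) / (2 - g_const) ..< g_const} \<times> {1 ..< G_const}
     else if \<alpha> = G_const then
       I_interval G_const \<times> {0 ..< 1}
     else
       I_interval \<alpha> \<times> {0 ..< 2 - G_const}
       \<union> {phi \<alpha> \<alpha> <..< \<alpha>} \<times> {2 - G_const <.. 1}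
       \<union> {phi \<alpha> (\<alpha> - 2) ..< \<alpha>} \<times> {1 ..< G_const})"

definition mu :: "real \<Rightarrow> (real \<times> real) measure" where
  "mu \<alpha> = density (restrict_space lborel (Omega \<alpha>))
            (\<lambda>(x, y). ennreal (1 / (1 + x * y)\<^sup>2))"

text \<open>
  \<open>T\<close> need not map \<open>space M\<close> into itself everywhere. If \<open>M\<close> is finite, the case
  \<open>A = space M\<close> shows that it does so almost everywhere.
\<close>

definition invariant_measure :: "'a measure \<Rightarrow> ('a \<Rightarrow> 'a) \<Rightarrow> bool" where
  "invariant_measure M T \<longleftrightarrow>
    (\<forall>A \<in> sets M. T -` A \<inter> space M \<in> sets M \<and>
       emeasure M (T -` A \<inter> space M) = emeasure M A)"

end

theory Submission
  imports Defs
begin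

text \<open>
  On the set where the digit is \<open>d\<close> and the sign is \<open>e\<close>, the map is injective with inverse
  \<open>(x, y) \<mapsto> (e / (d + x), e (1 / y - d))\<close>, and a direct computation shows that each such branch
  preserves \<open>dx dy / (1 + x y)\<^sup>2\<close>. Hence invariance amounts to the images of these cells tiling
  \<open>\<Omega>\<^sub>\<alpha>\<close> up to a null set: almost every point of \<open>\<Omega>\<^sub>\<alpha>\<close> must have exactly one preimage in
  \<open>\<Omega>\<^sub>\<alpha>\<close>. The total mass is the sum of explicit integrals over three rectangles; with
  \<open>W = \<alpha> + G - 1\<close> all logarithms collapse to \<open>3 ln G\<close>.
\<close>

section \<open>Substitutions under the Lebesgue integral\<close>

text \<open>Continuity from below of the measure with Lebesgue density \<open>h\<close>; it extends
  substitutions from compact intervals to half-lines.\<close>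

lemma set_nn_integral_exhaust:
  fixes h :: "real \<Rightarrow> ennreal"
  assumes [measurable]: "h \<in> borel_measurable borel" "\<And>n. A n \<in> sets borel" and "incseq A"
  shows "(SUP n. \<integral>\<^sup>+x. h x * indicator (A n) x \<partial>lborel) = (\<integral>\<^sup>+x. h x * indicator (\<Union>n. A n) x \<partial>lborel)"
  using SUP_emeasure_incseq[of A "density lborel h"] assms
  by (simp add: emeasure_density image_subset_iff)

text \<open>The map x to -1/x increases on the positive half-line, with derivative 1/x^2.
  Substitution for increasing maps therefore applies on each interval [1/b, b], and these intervals
  exhaust the half-line.\<close>

lemma nn_integral_neg_inverse_substitution:
  fixes h :: "real \<Rightarrow> ennreal"
  assumes [measurable]: "h \<in> borel_measurable borel"
  shows "(\<integral>\<^sup>+x. h x * indicator {..<0} x \<partial>lborel)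
       = (\<integral>\<^sup>+x. h (- 1 / x) * ennreal (1 / x\<^sup>2) * indicator {0<..} x \<partial>lborel)"
proof -
  \<comment> \<open>The shift by 2 makes \<open>b n\<close> exceed 1, so that 1 / \<open>b n\<close>
    < \<open>b n\<close>.\<close>
  define b where "b = (\<lambda>n. real (n + 2))"
  have b: "0 < b n" "1 / b n < b n" for n
    by (auto simp: b_def field_simps intro!: add_pos_nonneg)
  have b_mono: "b m \<le> b n" "1 / b n \<le> 1 / b m" if "m \<le> n" for m n
    using that by (auto simp: b_def field_simps)
  have piece: "(\<integral>\<^sup>+x. h x * indicator {- b n..- (1 / b n)} x \<partial>lborel)
      = (\<integral>\<^sup>+x. h (- 1 / x) * ennreal (1 / x\<^sup>2) * indicator {1 / b n..b n} x \<partial>lborel)" for n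
  proof -
    have pos: "0 < x" if "x \<in> {1 / b n..b n}" for x
      using that b(1)[of n] by (auto intro: less_le_trans[rotated])
    have "(\<integral>\<^sup>+x. h x * indicator {(\<lambda>x. - 1 / x) (1 / b n)..(\<lambda>x. - 1 / x) (b n)} x \<partial>lborel)
      = (\<integral>\<^sup>+x. h ((\<lambda>x. - 1 / x) x) * ennreal (1 / x\<^sup>2) * indicator {1 / b n..b n} x \<partial>lborel)"
    proof (rule nn_integral_substitution_aux)
      show "((\<lambda>x. - 1 / x) has_real_derivative 1 / x\<^sup>2) (at x)" if "x \<in> {1 / b n..b n}" for x
        using pos[OF that] by (auto intro!: derivative_eq_intros simp: power2_eq_square)
      show "continuous_on {1 / b n..b n} (\<lambda>x. 1 / x\<^sup>2)"
        using pos by (fastforce intro!: continuous_intros)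
    qed (use b in auto)
    then show ?thesis by simp
  qed
  have exh: "\<exists>n. x \<le> b n \<and> 1 / b n \<le> x" if "0 < x" for x
  proof -
    obtain n where "max x (1 / x) < real n" using reals_Archimedean2 by blast
    with that have "x \<le> b n \<and> 1 / b n \<le> x"
      by (auto simp: b_def field_simps intro: order_trans[OF _ mult_left_mono] add_increasing2)
    then show ?thesis ..
  qed
  have U: "(\<Union>n. {1 / b n..b n}) = {0<..}"
  proof (intro equalityI subsetI)
    fix x assume "x \<in> (\<Union>n. {1 / b n..b n})"
    then obtain n where "1 / b n \<le> x" by auto
    with less_le_trans[of 0 "1 / b n" x] b(1)[of n] show "x \<in> {0<..}" by simp
  next
    fix x :: real assume "x \<in> {0<..}"
    then show "x \<in> (\<Union>n. {1 / b n..b n})" using exh[of x] by auto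
  qed
  have "(\<Union>n. {- b n..- (1 / b n)}) = uminus ` (\<Union>n. {1 / b n..b n})"
    by (simp add: image_UN)
  then have V: "(\<Union>n. {- b n..- (1 / b n)}) = {..<0}"
    by (simp add: U)
  have "(\<integral>\<^sup>+x. h x * indicator {..<0} x \<partial>lborel)
      = (SUP n. \<integral>\<^sup>+x. h x * indicator {- b n..- (1 / b n)} x \<partial>lborel)"
    unfolding V[symmetric] using b_mono
    by (intro set_nn_integral_exhaust[symmetric]) (auto simp: incseq_def intro: order_trans)
  also have "\<dots> = (\<integral>\<^sup>+x. h (- 1 / x) * ennreal (1 / x\<^sup>2) * indicator {0<..} x \<partial>lborel)"
    unfolding U[symmetric] piece using b_mono
    by (intro set_nn_integral_exhaust) (auto simp: incseq_def intro: order_trans)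
  finally show ?thesis .
qed

lemma nn_integral_uminus_substitution:
  fixes h :: "real \<Rightarrow> ennreal"
  assumes "h \<in> borel_measurable borel"
  shows "(\<integral>\<^sup>+x. h x \<partial>lborel) = (\<integral>\<^sup>+x. h (- x) \<partial>lborel)"
  using nn_integral_real_affine[OF assms, of "-1" 0] by simp

lemma nn_integral_translation_substitution:
  fixes h :: "real \<Rightarrow> ennreal"
  assumes "h \<in> borel_measurable borel"
  shows "(\<integral>\<^sup>+x. h x \<partial>lborel) = (\<integral>\<^sup>+x. h (t + x) \<partial>lborel)"
  using nn_integral_real_affine[OF assms, of 1 t] by simp

lemma nn_integral_split_sign:
  fixes h :: "real \<Rightarrow> ennreal"
  assumes [measurable]: "h \<in> borel_measurable borel"
  shows "(\<integral>\<^sup>+x. h x \<partial>lborel) = (\<integral>\<^sup>+x. h x * indicator {..<0} x \<partial>lborel)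
     + (\<integral>\<^sup>+x. h x * indicator {0<..} x \<partial>lborel)"
proof -
  have "(\<integral>\<^sup>+x. h x \<partial>lborel) = (\<integral>\<^sup>+x. (h x * indicator {..<0} x + h x * indicator {0<..} x) \<partial>lborel)"
    using AE_lborel_singleton[of "0::real"]
    by (intro nn_integral_cong_AE) (auto elim!: eventually_mono split: split_indicator)
  then show ?thesis by (simp add: nn_integral_add)
qed

text \<open>Inversion is decreasing and breaks at 0. On each half-line it is the increasing map x to
  -1/x combined with a reflection, and the point 0 is null.\<close>

lemma nn_integral_inverse_substitution:
  fixes h :: "real \<Rightarrow> ennreal"
  assumes [measurable]: "h \<in> borel_measurable borel"
  shows "(\<integral>\<^sup>+x. h x \<partial>lborel) = (\<integral>\<^sup>+x. h (1 / x) * ennreal (1 / x\<^sup>2) \<partial>lborel)"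
proof -
  have reflect: "(\<integral>\<^sup>+x. k (- x) * indicator {0<..} x \<partial>lborel) = (\<integral>\<^sup>+x. k x * indicator {..<0} x \<partial>lborel)"
    if [measurable]: "k \<in> borel_measurable borel" for k :: "real \<Rightarrow> ennreal"
    by (subst nn_integral_uminus_substitution[of "\<lambda>x. k x * indicator {..<0} x"])
      (auto intro!: nn_integral_cong split: split_indicator)
  let ?k = "\<lambda>x. h (1 / x) * ennreal (1 / x\<^sup>2)"
  have "(\<integral>\<^sup>+x. h x * indicator {..<0} x \<partial>lborel) = (\<integral>\<^sup>+x. ?k x * indicator {..<0} x \<partial>lborel)"
    using nn_integral_neg_inverse_substitution[of h] reflect[of ?k] by simp
  moreover have "(\<integral>\<^sup>+x. h x * indicator {0<..} x \<partial>lborel) = (\<integral>\<^sup>+x. ?k x * indicator {0<..} x \<partial>lborel)"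
    using nn_integral_neg_inverse_substitution[of "\<lambda>x. h (- x)"] reflect[of "\<lambda>x. h (- x)"] by simp
  ultimately show ?thesis
    using nn_integral_split_sign[of h] nn_integral_split_sign[of ?k] by simp
qed

text \<open>Division by zero only affects the null lines \<open>x = - d\<close> and \<open>y = 0\<close>.\<close>

lemma nn_integral_inverse_branch:
  fixes F :: "real \<times> real \<Rightarrow> ennreal" and d e :: real
  assumes [measurable]: "F \<in> borel_measurable borel" and e: "e = 1 \<or> e = - 1"
  shows "(\<integral>\<^sup>+p. F p \<partial>lborel) = (\<integral>\<^sup>+(x, y). F (e / (d + x), e * (1 / y - d))
      * (ennreal (1 / (d + x)\<^sup>2) * ennreal (1 / y\<^sup>2)) \<partial>lborel)"
proof -
  have [measurable]: "F \<in> borel_measurable (borel \<Otimes>\<^sub>M borel)"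
    by (simp add: borel_prod)
  have sign: "(\<integral>\<^sup>+x. h x \<partial>lborel) = (\<integral>\<^sup>+x. h (e * x) \<partial>lborel)"
    if "h \<in> borel_measurable borel" for h :: "real \<Rightarrow> ennreal"
    using e nn_integral_uminus_substitution[OF that] by auto
  have y_part: "(\<integral>\<^sup>+y. k y \<partial>lborel) = (\<integral>\<^sup>+y. k (e * (1 / y - d)) * ennreal (1 / y\<^sup>2) \<partial>lborel)"
    if [measurable]: "k \<in> borel_measurable borel" for k :: "real \<Rightarrow> ennreal"
  proof -
    have "(\<integral>\<^sup>+y. k y \<partial>lborel) = (\<integral>\<^sup>+y. k (e * (- d + y)) \<partial>lborel)"
      by (subst sign, simp, rule nn_integral_translation_substitution) simp
    also have "\<dots> = (\<integral>\<^sup>+y. k (e * (- d + 1 / y)) * ennreal (1 / y\<^sup>2) \<partial>lborel)"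
      by (rule nn_integral_inverse_substitution) simp
    finally show ?thesis by simp
  qed
  have x_part: "(\<integral>\<^sup>+x. h x \<partial>lborel) = (\<integral>\<^sup>+x. h (e / (d + x)) * ennreal (1 / (d + x)\<^sup>2) \<partial>lborel)"
    if [measurable]: "h \<in> borel_measurable borel" for h :: "real \<Rightarrow> ennreal"
  proof -
    have "(\<integral>\<^sup>+x. h x \<partial>lborel) = (\<integral>\<^sup>+x. h (e * (1 / x)) * ennreal (1 / x\<^sup>2) \<partial>lborel)"
      by (subst sign, simp, rule nn_integral_inverse_substitution) simp
    also have "\<dots> = (\<integral>\<^sup>+x. h (e * (1 / (d + x))) * ennreal (1 / (d + x)\<^sup>2) \<partial>lborel)"
      by (rule nn_integral_translation_substitution) simp
    finally show ?thesis by simp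
  qed
  \<comment> \<open>Tonelli lets the two coordinates be substituted separately, since each new
    coordinate depends on one old coordinate only.\<close>
  have "(\<integral>\<^sup>+p. F p \<partial>lborel) = (\<integral>\<^sup>+x. \<integral>\<^sup>+y. F (x, y) \<partial>lborel \<partial>lborel)"
    by (subst lborel_prod[symmetric], rule lborel.nn_integral_fst[symmetric]) simp
  also have "\<dots> = (\<integral>\<^sup>+x. (\<integral>\<^sup>+y. F (e / (d + x), y) \<partial>lborel) * ennreal (1 / (d + x)\<^sup>2) \<partial>lborel)"
    by (rule x_part) simp
  also have "\<dots> = (\<integral>\<^sup>+x. \<integral>\<^sup>+y. F (e / (d + x), e * (1 / y - d))
      * (ennreal (1 / (d + x)\<^sup>2) * ennreal (1 / y\<^sup>2)) \<partial>lborel \<partial>lborel)"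
  proof (rule nn_integral_cong)
    fix x :: real
    show "(\<integral>\<^sup>+y. F (e / (d + x), y) \<partial>lborel) * ennreal (1 / (d + x)\<^sup>2)
      = (\<integral>\<^sup>+y. F (e / (d + x), e * (1 / y - d)) * (ennreal (1 / (d + x)\<^sup>2) * ennreal (1 / y\<^sup>2)) \<partial>lborel)"
      by (subst y_part[of "\<lambda>y. F (e / (d + x), y)"], simp, subst nn_integral_multc[symmetric], simp)
        (simp add: ac_simps)
  qed
  also have "\<dots> = (\<integral>\<^sup>+(x, y). F (e / (d + x), e * (1 / y - d))
      * (ennreal (1 / (d + x)\<^sup>2) * ennreal (1 / y\<^sup>2)) \<partial>lborel)"
    by (subst lborel_prod[symmetric], subst lborel.nn_integral_fst[symmetric]) (simp_all add: case_prod_beta)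
  finally show ?thesis .
qed

text \<open>Used to discard the edges of rectangles, the axes, and all preimages of such lines under
  countably many branches.\<close>

lemma AE_lborel_avoids_countable_lines:
  fixes C D :: "real set"
  assumes "countable C" "countable D"
  shows "AE p in lborel. fst p \<notin> C \<and> snd p \<notin> D"
proof -
  have [measurable]: "C \<in> sets borel" "D \<in> sets borel"
    using assms by (auto intro: sets.countable)
  have "AE x in lborel. x \<notin> C" "AE y in lborel. y \<notin> D"
    using assms by (auto intro!: AE_not_in countable_imp_null_set_lborel)
  then have "AE p in lborel \<Otimes>\<^sub>M lborel. fst p \<notin> C \<and> snd p \<notin> D"
    by (intro lborel_pair.AE_pair_measure) (measurable, auto)
  then show ?thesis unfolding lborel_prod .
qed

section \<open>The natural extension domain\<close>

lemma G_const_bounds: "1.6 < G_const" "G_const < 1.62"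
proof -
  have "2.2 < sqrt (5::real)" by (rule real_less_rsqrt) (simp add: power2_eq_square)
  moreover have "sqrt (5::real) < 2.24" by (rule real_less_lsqrt) (simp_all add: power2_eq_square)
  ultimately show "1.6 < G_const" "G_const < 1.62" by (simp_all add: G_const_def)
qed

lemma G_const_square: "G_const * G_const = G_const + 1"
  by (simp add: G_const_def field_simps)

lemma g_const_eq: "g_const = G_const - 1"
  by (simp add: g_const_def G_const_def field_simps)

text \<open>
  Evaluating \<open>\<phi>\<^sub>\<alpha>\<close> at the endpoints (where the digit is \<open>1\<close>) gives one formula that also covers
  \<open>\<alpha> = g\<close> and \<open>\<alpha> = G\<close>: the second, respectively the third, rectangle is then empty.
\<close>

definition Omega_open :: "real \<Rightarrow> (real \<times> real) set" where
  "Omega_open \<alpha> = {\<alpha> - 2<..<\<alpha>} \<times> {0<..<2 - G_const}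
     \<union> {1 / \<alpha> - 1<..<\<alpha>} \<times> {2 - G_const<..<1}
     \<union> {1 / (2 - \<alpha>) - 1<..<\<alpha>} \<times> {1<..<G_const}"

lemma borel_Omega [measurable]: "Omega \<alpha> \<in> sets borel"
  unfolding Omega_def I_interval_def by (simp add: borel_prod[symmetric])

lemma borel_Omega_open [measurable]: "Omega_open \<alpha> \<in> sets borel"
  unfolding Omega_open_def by (simp add: borel_prod[symmetric])

text \<open>As G - g = 1 and gG = 1, the two quadratic bounds are the expanded products (\<alpha> -
  g)(\<alpha> + G) \<ge> 0 and (G - \<alpha>)(\<alpha> + g) \<ge> 0.\<close>

lemma alpha_ineqs:
  assumes "\<alpha> \<in> {g_const..G_const}"
  shows "0.6 < \<alpha>" "\<alpha> < 1.62" "1 \<le> \<alpha> * \<alpha> + \<alpha>" "\<alpha> * \<alpha> \<le> \<alpha> + 1"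
proof -
  show "0.6 < \<alpha>" "\<alpha> < 1.62"
    using assms G_const_bounds by (auto simp: g_const_eq)
  have "0 \<le> (\<alpha> - g_const) * (\<alpha> + G_const)" "0 \<le> (G_const - \<alpha>) * (\<alpha> + g_const)"
    using assms G_const_bounds by (auto intro!: mult_nonneg_nonneg simp: g_const_eq)
  then show "1 \<le> \<alpha> * \<alpha> + \<alpha>" "\<alpha> * \<alpha> \<le> \<alpha> + 1"
    using G_const_square by (auto simp: g_const_eq algebra_simps)
qed

text \<open>Strictness matters: at \<alpha> = g the floor argument for x = \<alpha> reaches 1, and
  at \<alpha> = G the one for x = \<alpha> - 2 does, so that digit would jump to 3.\<close>

lemma digit_endpoints:
  assumes "g_const < \<alpha>" "\<alpha> < G_const"
  shows "digit \<alpha> \<alpha> = 1" "digit \<alpha> (\<alpha> - 2) = 1"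
proof -
  have "0 < (\<alpha> - g_const) * (\<alpha> + G_const)" "0 < (G_const - \<alpha>) * (\<alpha> + g_const)"
    using assms G_const_bounds by (auto intro!: mult_pos_pos simp: g_const_eq)
  then have *: "1 < \<alpha> * \<alpha> + \<alpha>" "\<alpha> * \<alpha> < \<alpha> + 1" "0 < \<alpha>" "\<alpha> < 2"
    using assms G_const_square G_const_bounds by (auto simp: g_const_eq algebra_simps)
  have "\<lfloor>1 / (2 * \<bar>\<alpha>\<bar>) + (1 - \<alpha>) / 2\<rfloor> = 0"
    using * by (intro floor_unique) (auto simp: field_simps)
  moreover have "\<lfloor>1 / (2 * \<bar>\<alpha> - 2\<bar>) + (1 - \<alpha>) / 2\<rfloor> = 0"
    using * zero_le_square[of "\<alpha> - 1"] by (intro floor_unique) (auto simp: field_simps abs_if)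
  ultimately show "digit \<alpha> \<alpha> = 1" "digit \<alpha> (\<alpha> - 2) = 1"
    by (simp_all add: digit_def)
qed

lemma mem_Omega_iff_open:
  assumes "\<alpha> \<in> {g_const..G_const}"
    and x: "x \<notin> {\<alpha> - 2, 1 / \<alpha> - 1, 1 / (2 - \<alpha>) - 1}" and y: "y \<notin> {0, 2 - G_const, 1}"
  shows "(x, y) \<in> Omega \<alpha> \<longleftrightarrow> (x, y) \<in> Omega_open \<alpha>"
proof -
  define a b where ab: "a = 1 / \<alpha> - 1" "b = 1 / (2 - \<alpha>) - 1"
  note G = G_const_bounds
  have x: "x \<noteq> \<alpha> - 2" "x \<noteq> a" "x \<noteq> b" and y: "y \<noteq> 0" "y \<noteq> 2 - G_const" "y \<noteq> 1"
    using x y by (auto simp: ab)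
  have g: "1 - g_const = 2 - G_const" "g_const \<noteq> G_const"
    by (simp_all add: g_const_eq)
  have open_eq: "Omega_open \<alpha> = {\<alpha> - 2<..<\<alpha>} \<times> {0<..<2 - G_const}
     \<union> {a<..<\<alpha>} \<times> {2 - G_const<..<1} \<union> {b<..<\<alpha>} \<times> {1<..<G_const}"
    by (simp add: Omega_open_def ab)
  consider "\<alpha> = g_const" | "\<alpha> = G_const" | "g_const < \<alpha>" "\<alpha> < G_const"
    using assms(1) by fastforce
  then show ?thesis
  proof cases
    case 1
    have sq: "\<alpha> * \<alpha> = 1 - \<alpha>"
      by (simp add: 1 g_const_def field_simps)
    have pos: "0 < \<alpha>" "\<alpha> < 1" using alpha_ineqs[OF assms(1)] G 1 by (simp_all add: g_const_eq)
    have "a = \<alpha>" "b = (\<alpha> - 1) / (2 - \<alpha>)"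
      using pos sq by (simp_all add: ab field_simps)
    then have eq: "Omega \<alpha> = {\<alpha> - 2..<\<alpha>} \<times> {0..<2 - G_const} \<union> {b..<\<alpha>} \<times> {1..<G_const}" "a = \<alpha>"
      by (simp_all add: Omega_def I_interval_def 1 g)
    show ?thesis unfolding open_eq eq using x y by auto
  next
    case 2
    have sq: "\<alpha> * \<alpha> = 1 + \<alpha>"
      by (simp add: 2 G_const_def field_simps)
    have pos: "0 < \<alpha>" "\<alpha> < 2" using alpha_ineqs[OF assms(1)] by simp_all
    \<comment> \<open>At \<alpha> = G the first two open rectangles also have equal width, so they
      join along the excluded line y = 2 - G.\<close>
    have eq: "a = \<alpha> - 2" "b = \<alpha>"
      using pos sq by (simp_all add: ab field_simps)
    have eq2: "Omega \<alpha> = {\<alpha> - 2..<\<alpha>} \<times> {0..<1}"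
      using g(2) by (simp add: Omega_def I_interval_def 2)
    show ?thesis unfolding open_eq eq eq2 using x y G by auto
  next
    case 3
    have "0 < \<alpha>" "\<alpha> < 2" using 3 G by (simp_all add: g_const_eq)
    then have "phi \<alpha> \<alpha> = a" "phi \<alpha> (\<alpha> - 2) = b"
      using 3 by (simp_all add: phi_def digit_endpoints ab)
    then have eq: "Omega \<alpha> = {\<alpha> - 2..<\<alpha>} \<times> {0..<2 - G_const}
        \<union> {a<..<\<alpha>} \<times> {2 - G_const<..1} \<union> {b..<\<alpha>} \<times> {1..<G_const}"
      using 3 by (simp add: Omega_def I_interval_def)
    show ?thesis unfolding open_eq eq using x y by auto
  qed
qed

lemma AE_mem_Omega_iff_open:
  assumes "\<alpha> \<in> {g_const..G_const}"
  shows "AE p in lborel. p \<in> Omega \<alpha> \<longleftrightarrow> p \<in> Omega_open \<alpha>"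
proof (rule eventually_mono)
  show "AE p in lborel. fst p \<notin> {\<alpha> - 2, 1 / \<alpha> - 1, 1 / (2 - \<alpha>) - 1} \<and> snd p \<notin> {0, 2 - G_const, 1}"
    by (rule AE_lborel_avoids_countable_lines) simp_all
  show "p \<in> Omega \<alpha> \<longleftrightarrow> p \<in> Omega_open \<alpha>"
    if "fst p \<notin> {\<alpha> - 2, 1 / \<alpha> - 1, 1 / (2 - \<alpha>) - 1} \<and> snd p \<notin> {0, 2 - G_const, 1}" for p
    using mem_Omega_iff_open[OF assms, of "fst p" "snd p"] that by simp
qed

section \<open>Inverse branches\<close>

text \<open>
  One index \<open>n\<close> encodes both the odd digit (by \<open>n div 2\<close>) and the sign (by the parity of \<open>n\<close>).
\<close>

definition cyl_digit :: "nat \<Rightarrow> real" where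
  "cyl_digit n = 2 * real (n div 2) + 1"

definition cyl_sign :: "nat \<Rightarrow> real" where
  "cyl_sign n = (if even n then 1 else - 1)"

definition cylinder :: "real \<Rightarrow> nat \<Rightarrow> real set" where
  "cylinder \<alpha> n = {x. of_int (digit \<alpha> x) = cyl_digit n \<and> sgn x = cyl_sign n}"

definition branch :: "nat \<Rightarrow> real \<times> real \<Rightarrow> real \<times> real" where
  "branch n = (\<lambda>(x, y). (cyl_sign n / (cyl_digit n + x), cyl_sign n * (1 / y - cyl_digit n)))"

lemma cyl_sign_cases: "cyl_sign n = 1 \<or> cyl_sign n = - 1"
  by (simp add: cyl_sign_def)

lemma cylinder_branch_pos:
  assumes "fst (branch n (x, y)) \<in> cylinder \<alpha> n"
  shows "0 < cyl_digit n + x"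
  using assms cyl_sign_cases[of n]
  by (auto simp: cylinder_def branch_def sgn_if zero_less_divide_iff split: if_splits)

lemma Phi_branch:
  assumes "fst (branch n (x, y)) \<in> cylinder \<alpha> n"
  shows "Phi \<alpha> (branch n (x, y)) = (x, y)"
proof -
  have pos: "0 < cyl_digit n + x" using assms by (rule cylinder_branch_pos)
  show ?thesis
    using assms pos cyl_sign_cases[of n]
    by (auto simp: Phi_def phi_def cylinder_def branch_def abs_mult)
qed

text \<open>With d = 2k + 1 the floor argument is k + (x + 2 - \<alpha>)/2, and the fraction lies in
  [0, 1) exactly when x is in [\<alpha> - 2, \<alpha>). Together with
  \<open>cylinder_branch_pos\<close> this reduces cylinder membership to the sign of d + x.\<close>

lemma branch_mem_cylinder:
  assumes "\<alpha> - 2 \<le> x" "x < \<alpha>" "0 < cyl_digit n + x"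
  shows "fst (branch n (x, y)) \<in> cylinder \<alpha> n"
proof -
  have "\<bar>cyl_sign n / (cyl_digit n + x)\<bar> = 1 / (cyl_digit n + x)"
    using assms cyl_sign_cases[of n] by auto
  moreover have "\<lfloor>1 / (2 * (1 / (cyl_digit n + x))) + (1 - \<alpha>) / 2\<rfloor> = int (n div 2)"
    using assms by (intro floor_unique) (auto simp: cyl_digit_def field_simps)
  ultimately have "of_int (digit \<alpha> (cyl_sign n / (cyl_digit n + x))) = cyl_digit n"
    by (simp add: digit_def) (simp add: cyl_digit_def)
  moreover have "sgn (cyl_sign n / (cyl_digit n + x)) = cyl_sign n"
    using assms cyl_sign_cases[of n] by auto
  ultimately show ?thesis by (simp add: cylinder_def branch_def)
qed

text \<open>The branch sends (x, y) to (X, Y) with 1 + XY = (1 + xy) / ((d + x) y), whose squared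
  denominator cancels against the Jacobian.\<close>

lemma density_branch:
  fixes x y d s :: real
  assumes "0 < d + x" "y \<noteq> 0" "s = 1 \<or> s = - 1"
  shows "1 / (1 + s / (d + x) * (s * (1 / y - d)))\<^sup>2 * (1 / (d + x)\<^sup>2 * (1 / y\<^sup>2)) = 1 / (1 + x * y)\<^sup>2"
proof -
  have "1 + s / (d + x) * (s * (1 / y - d)) = (1 + x * y) / ((d + x) * y)"
  proof -
    define z where "z = d + x"
    have "0 < z" "d = z - x" using assms by (simp_all add: z_def)
    then show ?thesis using assms by (auto simp: field_simps)
  qed
  then show ?thesis using assms by (simp add: power_mult_distrib power_divide)
qed

lemma Omega_openE:
  assumes "(x, y) \<in> Omega_open \<alpha>"
  shows "0 < y" "y < G_const" "x < \<alpha>"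
  using assms G_const_bounds by (auto simp: Omega_open_def)

lemma Omega_open_gt:
  assumes "\<alpha> \<in> {g_const..G_const}" "(x, y) \<in> Omega_open \<alpha>"
  shows "\<alpha> - 2 < x"
proof -
  have "\<alpha> - 2 \<le> 1 / \<alpha> - 1" "\<alpha> - 2 \<le> 1 / (2 - \<alpha>) - 1"
    using alpha_ineqs[OF assms(1)] zero_le_square[of "\<alpha> - 3/2"] by (auto simp: field_simps)
  then show ?thesis using assms by (auto simp: Omega_open_def)
qed

text \<open>Digit and sign determine the index; existence requires a positive digit, that is
  \<alpha> - 1 \<le> 1/|x|, which is checked against the endpoint on the same side of 0 as
  x.\<close>

lemma ex1_cylinder:
  assumes "\<alpha> \<in> {g_const..G_const}" "\<alpha> - 2 < x" "x < \<alpha>" "x \<noteq> 0"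
  shows "\<exists>!n. x \<in> cylinder \<alpha> n"
proof -
  note \<alpha> = alpha_ineqs[OF assms(1)]
  define m where "m = \<lfloor>1 / (2 * \<bar>x\<bar>) + (1 - \<alpha>) / 2\<rfloor>"
  have "\<alpha> - 1 \<le> 1 / \<bar>x\<bar>"
  proof (cases "x < 0")
    case True
    have "\<alpha> - 1 \<le> 1 / (2 - \<alpha>)"
      using \<alpha> zero_le_square[of "\<alpha> - 3/2"] by (auto simp: field_simps)
    also have "\<dots> \<le> 1 / \<bar>x\<bar>" using assms True \<alpha> by (auto simp: field_simps)
    finally show ?thesis .
  next
    case False
    have "\<alpha> - 1 \<le> 1 / \<alpha>" using \<alpha> by (auto simp: field_simps)
    also have "\<dots> \<le> 1 / \<bar>x\<bar>" using assms False \<alpha> by (auto simp: field_simps)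
    finally show ?thesis .
  qed
  moreover have "0 \<le> w / 2 + (1 - \<alpha>) / 2" if "\<alpha> - 1 \<le> w" for w
    using that by (simp add: field_simps)
  moreover have "1 / (2 * \<bar>x\<bar>) = 1 / \<bar>x\<bar> / 2" by simp
  ultimately have "0 \<le> 1 / (2 * \<bar>x\<bar>) + (1 - \<alpha>) / 2" by metis
  then have m: "0 \<le> m" by (simp only: m_def zero_le_floor)
  then obtain M where M: "m = int M" using nonneg_int_cases by blast
  have "of_int (2 * m + 1) = cyl_digit n \<and> sgn x = cyl_sign n
      \<longleftrightarrow> n = 2 * M + (if 0 < x then 0 else 1)" for n
  proof (cases "even n")
    case True
    then obtain b where "n = 2 * b" by blast
    then show ?thesis using assms(4) by (auto simp: M cyl_digit_def cyl_sign_def) presburger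
  next
    case False
    then obtain b where "n = 2 * b + 1" by (rule oddE)
    then show ?thesis using assms(4) by (auto simp: M cyl_digit_def cyl_sign_def) presburger
  qed
  then have "x \<in> cylinder \<alpha> n \<longleftrightarrow> n = 2 * M + (if 0 < x then 0 else 1)" for n
    by (simp only: cylinder_def digit_def m_def mem_Collect_eq)
  then show ?thesis by simp
qed

text \<open>
  With \<open>1 / y = 2 m + 1 + s\<close> and \<open>0 \<le> s < 2\<close>, only the digit \<open>2 m + 1\<close> with positive sign and the
  digit \<open>2 m + 3\<close> with negative sign can occur, with second coordinates \<open>s\<close> and \<open>2 - s\<close>. Both
  lie below \<open>G\<close> only for \<open>2 - G < s < G\<close>, and there the conditions imposed on the two first
  coordinates turn out to be complementary.
\<close>

lemma ex1_branch:
  assumes \<alpha>: "\<alpha> \<in> {g_const..G_const}" and xy: "(x, y) \<in> Omega_open \<alpha>"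
    and genx: "\<And>n. fst (branch n (x, y)) \<notin> {1 / \<alpha> - 1, 1 / (2 - \<alpha>) - 1}"
    and geny: "\<And>n. snd (branch n (x, y)) \<notin> {0, 2 - G_const, 1, G_const}"
  shows "\<exists>!n. branch n (x, y) \<in> Omega_open \<alpha> \<and> fst (branch n (x, y)) \<in> cylinder \<alpha> n"
proof -
  note ineqs = alpha_ineqs[OF \<alpha>] G_const_bounds
  have xr: "\<alpha> - 2 < x" "x < \<alpha>" and yr: "0 < y" "y < G_const"
    using Omega_open_gt[OF \<alpha> xy] Omega_openE[OF xy] by auto
  define Q where "Q n \<longleftrightarrow> branch n (x, y) \<in> Omega_open \<alpha> \<and> 0 < cyl_digit n + x" for n
  have Q_iff: "branch n (x, y) \<in> Omega_open \<alpha> \<and> fst (branch n (x, y)) \<in> cylinder \<alpha> n \<longleftrightarrow> Q n" for n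
    unfolding Q_def using branch_mem_cylinder[of \<alpha> x n y] cylinder_branch_pos[of n x y \<alpha>] xr by auto
  define t where "t = 1 / y"
  define m where "m = \<lfloor>(t - 1) / 2\<rfloor>"
  define s where "s = t - (2 * m + 1)"
  \<comment> \<open>\<open>z\<close> and \<open>z + 2\<close> are the denominators d + x of the
    positive and the negative candidate.\<close>
  define z where "z = 2 * m + 1 + x"
  have s: "0 \<le> s" "s < 2"
    using of_int_floor_le[of "(t - 1) / 2"] floor_less_iff[of "(t - 1) / 2" "m + 1"]
    unfolding s_def m_def[symmetric] by auto
  \<comment> \<open>This is y < G inverted, as 1/G = G - 1. Hence \<open>m\<close> is at least -1,
    and -1 occurs exactly for y > 1; then s = t + 1 > G and the positive candidate does not
    exist.\<close>
  have t_gt: "G_const - 1 < t"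
    using mult_strict_left_mono[of y G_const "G_const - 1"] yr G_const_square ineqs
    by (simp add: t_def field_simps)
  then have "- 1 < t - 1" using ineqs by linarith
  then have "- 1 \<le> (t - 1) / 2" by (simp add: field_simps)
  then have m: "- 1 \<le> m" by (simp add: m_def le_floor_iff)
  have s_m1: "G_const < s" if "m = - 1" using that t_gt by (simp add: s_def)
  \<comment> \<open>The even index 2m has digit 2m + 1 and sign +, the odd index 2m + 3 has digit 2m
    + 3 and sign -. For m = -1 truncation would make \<open>iP\<close> equal 0, hence the guard 0
    \<le> m.\<close>
  define iP where "iP = nat (2 * m)"
  define iN where "iN = nat (2 * m + 3)"
  have branchP: "branch iP (x, y) = (1 / z, s)" "cyl_digit iP + x = z" if "0 \<le> m"
    using that by (simp_all add: t_def branch_def cyl_digit_def cyl_sign_def iP_def z_def s_def nat_mult_distrib)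
  have "odd iN" "iN div 2 = nat (m + 1)"
    using m by (simp_all add: iN_def even_nat_iff nat_div_distrib[symmetric] flip: nat_div_distrib')
  then have branchN: "branch iN (x, y) = (- 1 / (z + 2), 2 - s)" "cyl_digit iN + x = z + 2"
    using m by (simp_all add: t_def branch_def cyl_digit_def cyl_sign_def z_def s_def)
  \<comment> \<open>The second coordinate of a branch with digit 2k + 1 is e(s + 2(m - k)). It must
    lie in (0, 2), which forces k = m for e = 1 and k = m + 1 for e = -1.\<close>
  have candidates: "(0 \<le> m \<and> n = iP) \<or> n = iN" if "Q n" for n
  proof -
    define k where "k = int (n div 2)"
    have k: "0 \<le> k" "cyl_digit n = 2 * k + 1" by (simp_all add: k_def cyl_digit_def)
    have "0 < snd (branch n (x, y))" "snd (branch n (x, y)) < 2"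
      using Omega_openE[of "fst (branch n (x, y))" "snd (branch n (x, y))" \<alpha>] that ineqs
      by (simp_all add: Q_def)
    then have r: "0 < cyl_sign n * (s + 2 * (m - k))" "cyl_sign n * (s + 2 * (m - k)) < 2"
      by (simp_all add: t_def branch_def k s_def algebra_simps)
    show ?thesis
    proof (cases "even n")
      case True
      then have "k = m" using r s by (simp add: cyl_sign_def)
      then show ?thesis using True k by (auto simp: iP_def k_def elim!: evenE)
    next
      case False
      then have "k = m + 1" using r s by (simp add: cyl_sign_def)
      then show ?thesis using False k by (auto simp: iN_def k_def elim!: oddE)
    qed
  qed
  have y_eq: "t = s + (2 * m + 1)" by (simp add: s_def)
  \<comment> \<open>For m = 0 the bound s < G gives y > 1/(1 + G) = 2 - G, so (x, y) lies in the
    second rectangle (y = 1 lies in none) and its left edge is the required bound. For larger m, x >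
    \<alpha> - 2 is enough.\<close>
  have z_gt: "1 / \<alpha> < z" if "0 \<le> m" "s < G_const"
  proof (cases "m = 0")
    case True
    then have "1 \<le> t" "t < 1 + G_const" using y_eq s that by auto
    then have "y \<le> 1" "1 < (1 + G_const) * y"
      using yr by (simp_all add: t_def field_simps)
    then have "2 - G_const < (2 - G_const) * (1 + G_const) * y"
      using mult_strict_left_mono[of 1 "(1 + G_const) * y" "2 - G_const"] ineqs by (simp add: mult.assoc)
    moreover have "(2 - G_const) * (1 + G_const) = 1" using G_const_square by (simp add: algebra_simps)
    ultimately have "y \<le> 1" "2 - G_const < y" using \<open>y \<le> 1\<close> by simp_all
    then have "1 / \<alpha> - 1 < x" using xy by (auto simp: Omega_open_def)
    then show ?thesis using True by (simp add: z_def)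
  next
    case False
    then have "1 \<le> real_of_int m" using that by linarith
    then have "1 + \<alpha> < z" using xr by (simp add: z_def)
    moreover have "1 / \<alpha> \<le> 1 + \<alpha>" using ineqs by (simp add: field_simps)
    ultimately show ?thesis by simp
  qed
  \<comment> \<open>Same argument for the negative candidate: m = -1 means y > 1, so the left edge
    of the third rectangle supplies the bound.\<close>
  have z2_gt: "1 / (2 - \<alpha>) < z + 2"
  proof (cases "m = - 1")
    case True
    then have "t < 1" using y_eq s by simp
    then have "1 < y" using yr by (simp add: t_def field_simps)
    then have "1 / (2 - \<alpha>) - 1 < x" using xy ineqs by (auto simp: Omega_open_def)
    then show ?thesis using True by (simp add: z_def)
  next
    case False
    then have "0 \<le> real_of_int m" using m by linarith
    then have "1 + \<alpha> < z + 2" using xr by (simp add: z_def)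
    moreover have "1 / (2 - \<alpha>) \<le> 1 + \<alpha>" using ineqs by (simp add: field_simps)
    ultimately show ?thesis by simp
  qed
  have inv_z: "0 < z" "1 / z < \<alpha>" if "0 \<le> m" "s < G_const"
  proof -
    have "0 < 1 / \<alpha>" using ineqs by simp
    with z_gt[OF that] show "0 < z" by linarith
    then show "1 / z < \<alpha>" using z_gt[OF that] ineqs by (simp add: field_simps)
  qed
  have inv_z2: "0 < z + 2" "1 / (z + 2) < 2 - \<alpha>"
  proof -
    have "0 < 1 / (2 - \<alpha>)" using ineqs by simp
    with z2_gt show "0 < z + 2" by linarith
    then show "1 / (z + 2) < 2 - \<alpha>" using z2_gt ineqs by (simp add: field_simps)
  qed
  have sP: "s \<notin> {0, 2 - G_const, 1, G_const}" if "0 \<le> m" using geny[of iP] branchP[OF that] by simp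
  have sN: "2 - s \<notin> {0, 2 - G_const, 1, G_const}" using geny[of iN] branchN by simp
  \<comment> \<open>The reflection s to 2 - s permutes the cut points 2 - G, 1, G. In the two outer
    cases one candidate lies above height G and the other falls in the full-width first
    rectangle.\<close>
  have "(0 \<le> m \<and> Q iP) \<noteq> Q iN"
  proof -
    consider "s < 2 - G_const" "0 \<le> m" | "2 - G_const < s" "s < 1" "0 \<le> m" | "1 < s" "s < G_const" "0 \<le> m" | "G_const < s"
      using sP sN s_m1 m by force
    then show ?thesis
    proof cases
      case 1
      then have "Q iP" using branchP inv_z s sP ineqs
        by (auto simp: Q_def Omega_open_def intro: less_trans[of _ 0])
      moreover have "\<not> Q iN" using branchN 1 G_const_bounds by (auto simp: Q_def Omega_open_def)
      ultimately show ?thesis using 1 by simp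
    next
      \<comment> \<open>The positive candidate is at the height of the second rectangle, the
        negative one at that of the third. Their left-edge conditions become (1 - \<alpha>)z <
        \<alpha> and (1 - \<alpha>)z > \<alpha>; \<open>genx\<close> rules out equality.\<close>
      case 2
      have z: "0 < z" "1 / z < \<alpha>" using inv_z 2 ineqs by auto
      have "1 / z \<noteq> 1 / \<alpha> - 1" using genx[of iP] branchP 2 by simp
      then have ne: "(1 - \<alpha>) * z \<noteq> \<alpha>" using z ineqs by (auto simp: field_simps)
      have "Q iP \<longleftrightarrow> 1 / \<alpha> - 1 < 1 / z" using branchP 2 z by (auto simp: Q_def Omega_open_def)
      also have "\<dots> \<longleftrightarrow> (1 - \<alpha>) * z < \<alpha>" using z ineqs by (simp add: field_simps)
      finally have P: "Q iP \<longleftrightarrow> (1 - \<alpha>) * z < \<alpha>" .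
      have "- 1 / (z + 2) < \<alpha>" using inv_z2 ineqs by (auto intro: less_trans[of _ 0])
      then have "Q iN \<longleftrightarrow> 1 / (2 - \<alpha>) - 1 < - 1 / (z + 2)"
        using branchN 2 inv_z2 by (auto simp: Q_def Omega_open_def)
      also have "\<dots> \<longleftrightarrow> \<alpha> < (1 - \<alpha>) * z" using inv_z2 ineqs by (simp add: field_simps)
      finally show ?thesis using P ne 2 by auto
    next
      \<comment> \<open>The two rectangles exchange roles, and the threshold becomes (\<alpha> - 1)z
        = 2 - \<alpha>.\<close>
      case 3
      have z: "0 < z" "1 / z < \<alpha>" using inv_z 3 by auto
      have "1 / z \<noteq> 1 / (2 - \<alpha>) - 1" using genx[of iP] branchP 3 by simp
      then have ne: "(\<alpha> - 1) * z \<noteq> 2 - \<alpha>" using z ineqs by (auto simp: field_simps)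
      have "Q iP \<longleftrightarrow> 1 / (2 - \<alpha>) - 1 < 1 / z" using branchP 3 z ineqs by (auto simp: Q_def Omega_open_def)
      also have "\<dots> \<longleftrightarrow> (\<alpha> - 1) * z < 2 - \<alpha>" using z ineqs by (simp add: field_simps)
      finally have P: "Q iP \<longleftrightarrow> (\<alpha> - 1) * z < 2 - \<alpha>" .
      have "- 1 / (z + 2) < \<alpha>" using inv_z2 ineqs by (auto intro: less_trans[of _ 0])
      then have "Q iN \<longleftrightarrow> 1 / \<alpha> - 1 < - 1 / (z + 2)"
        using branchN 3 inv_z2 by (auto simp: Q_def Omega_open_def)
      also have "\<dots> \<longleftrightarrow> 2 - \<alpha> < (\<alpha> - 1) * z" using inv_z2 ineqs by (simp add: field_simps)
      finally show ?thesis using P ne 3 by auto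
    next
      case 4
      have "- 1 / (z + 2) < \<alpha>" using inv_z2 ineqs by (auto intro: less_trans[of _ 0])
      then have "Q iN" using branchN inv_z2 4 s G_const_bounds by (auto simp: Q_def Omega_open_def)
      moreover have "\<not> (0 \<le> m \<and> Q iP)" using branchP 4 G_const_bounds by (auto simp: Q_def Omega_open_def)
      ultimately show ?thesis by simp
    qed
  qed
  then show ?thesis unfolding Q_iff using candidates by metis
qed

section \<open>Total mass\<close>

text \<open>Turns the two uniqueness statements, one cylinder per point and one preimage per point,
  into identities between series of integrands.\<close>

lemma ex1_suminf_ennreal:
  fixes c :: ennreal
  assumes "\<exists>!n. P n"
  shows "(\<Sum>n. c * (if P n then 1 else 0)) = c"
proof -
  obtain i where "P n \<longleftrightarrow> n = i" for n using assms by metis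
  then have "(\<lambda>n. c * (if P n then 1 else 0)) = (\<lambda>n. if n = i then c else 0)"
    by auto
  then show ?thesis using sums_unique[OF sums_single[of i "\<lambda>_. c"]] by simp
qed

text \<open>Positivity of 1 + xy on the whole rectangle follows from the corner (a, d). Allowing a =
  b covers the rectangles that collapse at \<alpha> = g and \<alpha> = G.\<close>

lemma nn_integral_density_rectangle:
  fixes a b c d :: real
  assumes ab: "a \<le> b" and cd: "0 \<le> c" "c \<le> d" and corner: "0 < 1 + a * d"
  defines "V \<equiv> ln (1 + b * d) - ln (1 + a * d) - ln (1 + b * c) + ln (1 + a * c)"
  shows "(\<integral>\<^sup>+p. ennreal (1 / (1 + fst p * snd p)\<^sup>2) * indicator ({a<..<b} \<times> {c<..<d}) p \<partial>lborel) = ennreal V"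
    and "0 \<le> V"
proof -
  have pos: "0 < 1 + x * y" if "a \<le> x" "c \<le> y" "y \<le> d" for x y
  proof -
    have "a * y \<le> x * y" using that cd by (intro mult_right_mono) auto
    moreover have "0 < 1 + a * y"
    proof (cases "0 \<le> a")
      case True then show ?thesis using that cd by (simp add: add_pos_nonneg)
    next
      case False
      then have "a * d \<le> a * y" using that by (intro mult_left_mono_neg) auto
      then show ?thesis using corner by linarith
    qed
    ultimately show ?thesis by linarith
  qed
  define F where "F x = ln (1 + x * d) - ln (1 + x * c)" for x
  define f where "f x = d / (1 + x * d) - c / (1 + x * c)" for x
  have F_deriv: "(F has_real_derivative f x) (at x)" if "a \<le> x" for x
    unfolding F_def f_def using pos[of x c] pos[of x d] that cd
    by (auto intro!: derivative_eq_intros simp: field_simps)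
  have f_nonneg: "0 \<le> f x" if "a \<le> x" for x
  proof -
    have p: "0 < 1 + x * c" "0 < 1 + x * d" using pos[of x c] pos[of x d] that cd by auto
    then have "f x = (d - c) / ((1 + x * c) * (1 + x * d))"
      by (simp add: f_def diff_frac_eq) (simp add: algebra_simps)
    then show ?thesis using p cd by simp
  qed
  have inner: "(\<integral>\<^sup>+y. ennreal (1 / (1 + x * y)\<^sup>2) * indicator {c..d} y \<partial>lborel) = ennreal (f x)"
    if "a \<le> x" for x
  proof -
    \<comment> \<open>The antiderivative y / (1 + xy) involves no division by x, so x = 0 is not a
      special case.\<close>
    have "(\<integral>\<^sup>+y. ennreal (1 / (1 + x * y)\<^sup>2) * indicator {c..d} y \<partial>lborel)
      = ennreal ((\<lambda>y. y / (1 + x * y)) d - (\<lambda>y. y / (1 + x * y)) c)"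
    proof (rule nn_integral_FTC_Icc)
      show "((\<lambda>y. y / (1 + x * y)) has_real_derivative 1 / (1 + x * y)\<^sup>2) (at y)" if "y \<in> {c..d}" for y
        using pos[of x y] that \<open>a \<le> x\<close>
        by (auto intro!: derivative_eq_intros simp: power2_eq_square)
    qed (use cd in auto)
    then show ?thesis by (simp add: f_def)
  qed
  have "0 \<le> F b - F a"
    using DERIV_nonneg_imp_nondecreasing[OF ab, of F] F_deriv f_nonneg by force
  then show "0 \<le> V" by (simp add: F_def V_def)
  have "AE p in lborel. fst p \<notin> {a, b} \<and> snd p \<notin> {c, d}"
    by (rule AE_lborel_avoids_countable_lines) auto
  then have "(\<integral>\<^sup>+p. ennreal (1 / (1 + fst p * snd p)\<^sup>2) * indicator ({a<..<b} \<times> {c<..<d}) p \<partial>lborel)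
    = (\<integral>\<^sup>+p. ennreal (1 / (1 + fst p * snd p)\<^sup>2) * indicator ({a..b} \<times> {c..d}) p \<partial>(lborel \<Otimes>\<^sub>M lborel))"
    unfolding lborel_prod
    by (intro nn_integral_cong_AE, elim eventually_mono) (auto split: split_indicator)
  also have "\<dots> = (\<integral>\<^sup>+x. \<integral>\<^sup>+y. ennreal (1 / (1 + x * y)\<^sup>2) * indicator ({a..b} \<times> {c..d}) (x, y) \<partial>lborel \<partial>lborel)"
    by (subst lborel.nn_integral_fst[symmetric]) simp_all
  also have "\<dots> = (\<integral>\<^sup>+x. (\<integral>\<^sup>+y. ennreal (1 / (1 + x * y)\<^sup>2) * indicator {c..d} y \<partial>lborel) * indicator {a..b} x \<partial>lborel)"
    by (subst nn_integral_multc[symmetric]) (auto intro!: nn_integral_cong split: split_indicator)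
  also have "\<dots> = (\<integral>\<^sup>+x. ennreal (f x) * indicator {a..b} x \<partial>lborel)"
    using inner by (intro nn_integral_cong) (auto split: split_indicator)
  also have "\<dots> = ennreal (F b - F a)"
  proof (rule nn_integral_FTC_Icc[OF _ _ _ ab])
    show "f \<in> borel_measurable borel" unfolding f_def by measurable
  qed (use F_deriv f_nonneg in auto)
  finally show "(\<integral>\<^sup>+p. ennreal (1 / (1 + fst p * snd p)\<^sup>2) * indicator ({a<..<b} \<times> {c<..<d}) p \<partial>lborel) = ennreal V"
    by (simp add: F_def V_def algebra_simps)
qed

lemma emeasure_mu:
  assumes "A \<subseteq> Omega \<alpha>" "A \<in> sets borel"
  shows "emeasure (mu \<alpha>) A = (\<integral>\<^sup>+p. ennreal (1 / (1 + fst p * snd p)\<^sup>2) * indicator A p \<partial>lborel)"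
proof -
  have [measurable]: "A \<in> sets borel" by fact
  have *: "(\<lambda>p::real \<times> real. ennreal (1 / (1 + fst p * snd p)\<^sup>2)) \<in> borel_measurable borel"
    unfolding borel_prod[symmetric] by measurable
  have "emeasure (mu \<alpha>) A = (\<integral>\<^sup>+p. ennreal (1 / (1 + fst p * snd p)\<^sup>2) * indicator A p \<partial>restrict_space lborel (Omega \<alpha>))"
    unfolding mu_def case_prod_beta using assms *
    by (intro emeasure_density) (auto simp: sets_restrict_space_iff intro: measurable_restrict_space1)
  also have "\<dots> = (\<integral>\<^sup>+p. ennreal (1 / (1 + fst p * snd p)\<^sup>2) * indicator A p * indicator (Omega \<alpha>) p \<partial>lborel)"
    by (rule nn_integral_restrict_space) simp
  also have "\<dots> = (\<integral>\<^sup>+p. ennreal (1 / (1 + fst p * snd p)\<^sup>2) * indicator A p \<partial>lborel)"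
    using assms by (intro nn_integral_cong) (auto split: split_indicator)
  finally show ?thesis .
qed

lemma sets_mu: "A \<in> sets (mu \<alpha>) \<longleftrightarrow> A \<subseteq> Omega \<alpha> \<and> A \<in> sets borel"
  unfolding mu_def by (simp add: sets_restrict_space_iff)

lemma space_mu: "space (mu \<alpha>) = Omega \<alpha>"
  by (simp add: mu_def space_restrict_space)

lemma emeasure_mu_Omega:
  assumes "\<alpha> \<in> {g_const..G_const}"
  shows "emeasure (mu \<alpha>) (Omega \<alpha>) = ennreal (3 * ln G_const)"
proof -
  note ineqs = alpha_ineqs[OF assms] G_const_bounds
  let ?f = "\<lambda>p::real \<times> real. ennreal (1 / (1 + fst p * snd p)\<^sup>2)"
  define h where "h = 2 - G_const"
  define a where "a = 1 / \<alpha> - 1"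
  define b where "b = 1 / (2 - \<alpha>) - 1"
  define V where "V x z c d = ln (1 + z * d) - ln (1 + x * d) - ln (1 + z * c) + ln (1 + x * c)" for x z c d :: real
  define R1 where "R1 = {\<alpha> - 2<..<\<alpha>} \<times> {0<..<h}"
  define R2 where "R2 = {a<..<\<alpha>} \<times> {h<..<1}"
  define R3 where "R3 = {b<..<\<alpha>} \<times> {1<..<G_const}"
  have [measurable]: "R1 \<in> sets borel" "R2 \<in> sets borel" "R3 \<in> sets borel"
    unfolding R1_def R2_def R3_def by (simp_all add: borel_prod[symmetric])
  have [measurable]: "?f \<in> borel_measurable borel"
    unfolding borel_prod[symmetric] by measurable
  have h: "0 < h" "h < 1/2" using ineqs by (simp_all add: h_def)
  have a: "a \<le> \<alpha>" "1 + a = 1 / \<alpha>" and b: "b \<le> \<alpha>" "1 + b = 1 / (2 - \<alpha>)"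
    using ineqs by (simp_all add: a_def b_def field_simps)
  define W where "W = \<alpha> + G_const - 1"
  have Gh: "G_const * h = G_const - 1" "G_const * G_const * h = 1"
    using G_const_square by (simp_all add: h_def algebra_simps)
  have W: "0 < W" using ineqs by (simp add: W_def)
  \<comment> \<open>\<open>c1\<close> to \<open>c4\<close> express corner values of 1 + xy as
    \<open>W\<close> times a monomial in G, \<alpha> and 2 - \<alpha> with integer
    exponents.\<close>
  have c1: "1 + (\<alpha> - 2) * h = W / (G_const * G_const)"
  proof -
    have "(1 + (\<alpha> - 2) * h) * (G_const * G_const) = G_const * G_const + (\<alpha> - 2) * (G_const * G_const * h)"
      by (simp add: algebra_simps)
    also have "\<dots> = W" by (simp only: Gh(2)) (simp add: G_const_square W_def)
    finally show ?thesis using ineqs by (simp add: nonzero_eq_divide_eq)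
  qed
  have c2: "1 + a * h = W / (G_const * \<alpha>)"
  proof -
    have "(1 + a * h) * (G_const * \<alpha>) = G_const * \<alpha> + (1 + a) * \<alpha> * (G_const * h) - \<alpha> * (G_const * h)"
      by (simp add: algebra_simps)
    also have "\<dots> = W" using ineqs by (simp add: Gh a W_def algebra_simps)
    finally show ?thesis using ineqs by (simp add: nonzero_eq_divide_eq)
  qed
  have c3: "1 + b * G_const = W / (G_const * (2 - \<alpha>))"
  proof -
    have "(1 + b * G_const) * (G_const * (2 - \<alpha>))
      = G_const * (2 - \<alpha>) + (1 + b) * (2 - \<alpha>) * (G_const * G_const) - (2 - \<alpha>) * (G_const * G_const)"
      by (simp add: algebra_simps)
    also have "\<dots> = W" using ineqs by (simp add: G_const_square b W_def algebra_simps)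
    finally show ?thesis using ineqs by (simp add: nonzero_eq_divide_eq)
  qed
  have c4: "1 + \<alpha> * G_const = W * G_const"
    using G_const_square by (simp add: W_def algebra_simps)
  have r1: "(\<integral>\<^sup>+p. ?f p * indicator R1 p \<partial>lborel) = ennreal (V (\<alpha> - 2) \<alpha> 0 h)" "0 \<le> V (\<alpha> - 2) \<alpha> 0 h"
    unfolding R1_def V_def using h c1 W ineqs
    by (intro nn_integral_density_rectangle; simp)+
  have r2: "(\<integral>\<^sup>+p. ?f p * indicator R2 p \<partial>lborel) = ennreal (V a \<alpha> h 1)" "0 \<le> V a \<alpha> h 1"
    unfolding R2_def V_def using h a ineqs
    by (intro nn_integral_density_rectangle; simp)+
  have r3: "(\<integral>\<^sup>+p. ?f p * indicator R3 p \<partial>lborel) = ennreal (V b \<alpha> 1 G_const)" "0 \<le> V b \<alpha> 1 G_const"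
    unfolding R3_def V_def using b c3 W ineqs
    by (intro nn_integral_density_rectangle; simp)+
  have "emeasure (mu \<alpha>) (Omega \<alpha>) = (\<integral>\<^sup>+p. ?f p * indicator (Omega \<alpha>) p \<partial>lborel)"
    by (rule emeasure_mu) auto
  also have "\<dots> = (\<integral>\<^sup>+p. ?f p * indicator (Omega_open \<alpha>) p \<partial>lborel)"
    using AE_mem_Omega_iff_open[OF assms]
    by (intro nn_integral_cong_AE) (auto elim!: eventually_mono split: split_indicator)
  also have "Omega_open \<alpha> = R1 \<union> R2 \<union> R3"
    by (simp add: Omega_open_def R1_def R2_def R3_def h_def a_def b_def)
  also have "(\<integral>\<^sup>+p. ?f p * indicator (R1 \<union> R2 \<union> R3) p \<partial>lborel)
      = (\<integral>\<^sup>+p. ?f p * indicator R1 p + ?f p * indicator R2 p + ?f p * indicator R3 p \<partial>lborel)"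
    using h by (intro nn_integral_cong) (auto split: split_indicator simp: R1_def R2_def R3_def)
  also have "\<dots> = ennreal (V (\<alpha> - 2) \<alpha> 0 h + V a \<alpha> h 1 + V b \<alpha> 1 G_const)"
    using r1 r2 r3 by (simp add: nn_integral_add)
  \<comment> \<open>The terms ln(1 + \<alpha>h) and ln(1 + \<alpha>) cancel between adjacent
    rectangles. In the rest ln W, ln \<alpha> and ln(2 - \<alpha>) cancel, and ln G occurs with
    total weight 2 - 1 + 1 + 1 = 3.\<close>
  also have "V (\<alpha> - 2) \<alpha> 0 h + V a \<alpha> h 1 + V b \<alpha> 1 G_const = 3 * ln G_const"
    using ineqs W by (simp add: V_def c1 c2 c3 c4 a b ln_mult ln_div)
  finally show ?thesis .
qed

section \<open>Invariance\<close>

lemma measurable_digit [measurable]: "digit \<alpha> \<in> borel \<rightarrow>\<^sub>M count_space UNIV"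
  unfolding digit_def by measurable

lemma borel_cylinder [measurable]: "cylinder \<alpha> n \<in> sets borel"
proof -
  have "{x \<in> space borel. real_of_int (digit \<alpha> x) = cyl_digit n \<and> sgn x = cyl_sign n} \<in> sets borel"
    by measurable
  then show ?thesis by (simp add: cylinder_def)
qed

lemma borel_measurable_Phi [measurable]: "Phi \<alpha> \<in> borel \<rightarrow>\<^sub>M borel"
  unfolding Phi_def phi_def borel_prod[symmetric] by measurable

lemma borel_measurable_branch [measurable]: "branch n \<in> borel \<rightarrow>\<^sub>M borel"
  unfolding branch_def borel_prod[symmetric] by measurable

text \<open>Every branch is injective in each coordinate, so the exceptional coordinates form
  countable sets over all n.\<close>

lemma AE_branch_avoids_finite:
  assumes "finite X" "finite Y"
  shows "AE p in lborel. \<forall>n. fst (branch n p) \<notin> X \<and> snd (branch n p) \<notin> Y"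
proof -
  define C where "C = (\<Union>n. (\<lambda>b. cyl_sign n / b - cyl_digit n) ` X)"
  define D where "D = (\<Union>n. (\<lambda>b. 1 / (cyl_sign n * b + cyl_digit n)) ` Y)"
  have "AE p in lborel. fst p \<notin> C \<and> snd p \<notin> D"
    using assms unfolding C_def D_def
    by (intro AE_lborel_avoids_countable_lines countable_UN countable_image) (auto intro: countable_finite)
  then show ?thesis
  proof (rule eventually_mono, intro allI)
    fix p :: "real \<times> real" and n
    assume p: "fst p \<notin> C \<and> snd p \<notin> D"
    obtain x y where xy: "p = (x, y)" by fastforce
    define X' where "X' = fst (branch n p)"
    define Y' where "Y' = snd (branch n p)"
    \<comment> \<open>These inversion formulas hold even for d + x = 0 and y = 0, because division
      by zero yields zero.\<close>
    have "x = cyl_sign n / X' - cyl_digit n" "y = 1 / (cyl_sign n * Y' + cyl_digit n)"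
      using cyl_sign_cases[of n] by (auto simp: X'_def Y'_def branch_def xy)
    then have "X' \<notin> X" "Y' \<notin> Y" using p by (auto simp: C_def D_def xy)
    then show "fst (branch n p) \<notin> X \<and> snd (branch n p) \<notin> Y" by (simp add: X'_def Y'_def)
  qed
qed

lemma AE_ex1_branch:
  assumes "\<alpha> \<in> {g_const..G_const}"
  shows "AE p in lborel. p \<in> Omega_open \<alpha> \<longrightarrow>
    (\<exists>!n. branch n p \<in> Omega_open \<alpha> \<and> fst (branch n p) \<in> cylinder \<alpha> n)"
proof (rule eventually_mono)
  show "AE p in lborel. \<forall>n. fst (branch n p) \<notin> {1 / \<alpha> - 1, 1 / (2 - \<alpha>) - 1}
      \<and> snd (branch n p) \<notin> {0, 2 - G_const, 1, G_const}"
    by (rule AE_branch_avoids_finite) auto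
  fix p
  assume "\<forall>n. fst (branch n p) \<notin> {1 / \<alpha> - 1, 1 / (2 - \<alpha>) - 1}
      \<and> snd (branch n p) \<notin> {0, 2 - G_const, 1, G_const}"
  then show "p \<in> Omega_open \<alpha> \<longrightarrow> (\<exists>!n. branch n p \<in> Omega_open \<alpha> \<and> fst (branch n p) \<in> cylinder \<alpha> n)"
    using ex1_branch[OF assms, of "fst p" "snd p"] by simp
qed

text \<open>The preimage of A is cut into cells, each cell is transported by its inverse branch, and
  the pieces are summed again over A. Unique cylinders justify the first sum, unique preimages the
  last.\<close>

lemma emeasure_mu_vimage_Phi:
  assumes \<alpha>: "\<alpha> \<in> {g_const..G_const}" and A: "A \<subseteq> Omega \<alpha>" "A \<in> sets borel"
  shows "emeasure (mu \<alpha>) (Phi \<alpha> -` A \<inter> Omega \<alpha>) = emeasure (mu \<alpha>) A"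
proof -
  define f where "f p = ennreal (1 / (1 + fst p * snd p)\<^sup>2)" for p :: "real \<times> real"
  have [measurable]: "A \<in> sets borel" by fact
  have [measurable]: "f \<in> borel_measurable borel"
    unfolding f_def borel_prod[symmetric] by measurable
  have [measurable]: "Phi \<alpha> -` A \<in> sets borel"
    using measurable_sets[OF borel_measurable_Phi \<open>A \<in> sets borel\<close>] by simp
  define cell where "cell n = {p \<in> Omega_open \<alpha>. fst p \<in> cylinder \<alpha> n}" for n
  have [measurable]: "cell n \<in> sets borel" for n
  proof -
    have "cell n = Omega_open \<alpha> \<inter> (cylinder \<alpha> n \<times> UNIV)" by (auto simp: cell_def)
    then show ?thesis by (simp add: borel_Times sets.Int)
  qed
  define H where "H n p = f p * indicator (Phi \<alpha> -` A) p * (if p \<in> cell n then 1 else 0)" for n p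
  have [measurable]: "H n \<in> borel_measurable borel" for n
    unfolding H_def by measurable
  \<comment> \<open>The image of a cell is described by testing whether the inverse branch lands in
    the cell, so measurability of images never arises.\<close>
  define K where "K n q = f q * indicator A q * (if branch n q \<in> cell n then 1 else 0)" for n q
  have [measurable]: "K n \<in> borel_measurable borel" for n
    unfolding K_def by measurable
  have HK: "(\<integral>\<^sup>+p. H n p \<partial>lborel) = (\<integral>\<^sup>+q. K n q \<partial>lborel)" for n
  proof -
    have "(\<integral>\<^sup>+p. H n p \<partial>lborel) = (\<integral>\<^sup>+(x, y). H n (cyl_sign n / (cyl_digit n + x), cyl_sign n * (1 / y - cyl_digit n))
      * (ennreal (1 / (cyl_digit n + x)\<^sup>2) * ennreal (1 / y\<^sup>2)) \<partial>lborel)"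
      by (rule nn_integral_inverse_branch) (simp_all add: cyl_sign_cases)
    also have "\<dots> = (\<integral>\<^sup>+q. K n q \<partial>lborel)"
    proof (rule nn_integral_cong_AE, rule eventually_mono)
      \<comment> \<open>Only y = 0 has to be discarded: on the line x = -d the branch misses its
        cell, and both sides vanish.\<close>
      show "AE q in lborel. fst q \<notin> ({}::real set) \<and> snd q \<notin> {0::real}"
        by (rule AE_lborel_avoids_countable_lines) auto
      fix q :: "real \<times> real" assume q: "fst q \<notin> {} \<and> snd q \<notin> {0}"
      obtain x y where xy: "q = (x, y)" by fastforce
      have y: "y \<noteq> 0" using q xy by simp
      have br: "(cyl_sign n / (cyl_digit n + x), cyl_sign n * (1 / y - cyl_digit n)) = branch n q"
        by (simp add: branch_def xy)
      have "H n (branch n q) * (ennreal (1 / (cyl_digit n + x)\<^sup>2) * ennreal (1 / y\<^sup>2)) = K n q"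
      proof (cases "branch n q \<in> cell n")
        case True
        then have c: "fst (branch n (x, y)) \<in> cylinder \<alpha> n" by (simp add: cell_def xy)
        have "f (branch n q) * (ennreal (1 / (cyl_digit n + x)\<^sup>2) * ennreal (1 / y\<^sup>2)) = f q"
          unfolding f_def xy branch_def
          using density_branch[OF cylinder_branch_pos[OF c] y cyl_sign_cases[of n]]
          by (simp add: ennreal_mult'[symmetric])
        then show ?thesis
          using True Phi_branch[OF c] by (simp add: H_def K_def xy indicator_def)
      qed (simp add: H_def K_def)
      then show "(case q of (x, y) \<Rightarrow> H n (cyl_sign n / (cyl_digit n + x), cyl_sign n * (1 / y - cyl_digit n))
        * (ennreal (1 / (cyl_digit n + x)\<^sup>2) * ennreal (1 / y\<^sup>2))) = K n q"
        unfolding br[symmetric] by (simp add: xy)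
    qed
    finally show ?thesis .
  qed
  have "emeasure (mu \<alpha>) (Phi \<alpha> -` A \<inter> Omega \<alpha>) = (\<integral>\<^sup>+p. f p * indicator (Phi \<alpha> -` A \<inter> Omega \<alpha>) p \<partial>lborel)"
    unfolding f_def by (rule emeasure_mu) auto
  also have "\<dots> = (\<integral>\<^sup>+p. (\<Sum>n. H n p) \<partial>lborel)"
  proof (rule nn_integral_cong_AE)
    have "AE p in lborel. fst p \<notin> {0::real} \<and> snd p \<notin> ({}::real set)"
      by (rule AE_lborel_avoids_countable_lines) auto
    with AE_mem_Omega_iff_open[OF \<alpha>]
    show "AE p in lborel. f p * indicator (Phi \<alpha> -` A \<inter> Omega \<alpha>) p = (\<Sum>n. H n p)"
    proof eventually_elim
      case (elim p)
      show ?case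
      proof (cases "p \<in> Omega_open \<alpha>")
        case True
        then have "\<exists>!n. fst p \<in> cylinder \<alpha> n"
          using Omega_open_gt[OF \<alpha>, of "fst p" "snd p"] Omega_openE(3)[of "fst p" "snd p" \<alpha>] elim
          by (intro ex1_cylinder[OF \<alpha>]) auto
        then have "\<exists>!n. p \<in> cell n" using True by (simp add: cell_def)
        from ex1_suminf_ennreal[OF this] show ?thesis
          using True elim by (simp only: H_def) (simp add: indicator_def)
      next
        case False
        then show ?thesis using elim by (simp add: H_def cell_def)
      qed
    qed
  qed
  also have "\<dots> = (\<Sum>n. \<integral>\<^sup>+p. H n p \<partial>lborel)" by (rule nn_integral_suminf) simp
  also have "\<dots> = (\<Sum>n. \<integral>\<^sup>+q. K n q \<partial>lborel)" by (simp only: HK)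
  also have "\<dots> = (\<integral>\<^sup>+q. (\<Sum>n. K n q) \<partial>lborel)" by (rule nn_integral_suminf[symmetric]) simp
  also have "\<dots> = (\<integral>\<^sup>+q. f q * indicator A q \<partial>lborel)"
  proof (rule nn_integral_cong_AE)
    show "AE q in lborel. (\<Sum>n. K n q) = f q * indicator A q"
      using AE_mem_Omega_iff_open[OF \<alpha>] AE_ex1_branch[OF \<alpha>]
    proof eventually_elim
      case (elim q)
      show ?case
      proof (cases "q \<in> A")
        case True
        then have "\<exists>!n. branch n q \<in> cell n" using elim A by (auto simp: cell_def)
        from ex1_suminf_ennreal[OF this] show ?thesis by (simp only: K_def)
      qed (simp add: K_def)
    qed
  qed
  also have "\<dots> = emeasure (mu \<alpha>) A"
    unfolding f_def by (rule emeasure_mu[symmetric]) fact+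
  finally show ?thesis .
qed

theorem lemma11:
  fixes \<alpha> :: real
  assumes "\<alpha> \<in> {g_const .. G_const}"
  shows "invariant_measure (mu \<alpha>) (Phi \<alpha>) \<and>
         emeasure (mu \<alpha>) (Omega \<alpha>) = ennreal (3 * ln G_const)"
proof
  have "Phi \<alpha> -` A \<inter> Omega \<alpha> \<in> sets borel" if "A \<in> sets borel" for A
    using measurable_sets[OF borel_measurable_Phi that] by (simp add: sets.Int)
  then show "invariant_measure (mu \<alpha>) (Phi \<alpha>)"
    using emeasure_mu_vimage_Phi[OF assms]
    by (auto simp: invariant_measure_def sets_mu space_mu)
qed (rule emeasure_mu_Omega[OF assms])

end
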